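(* Let $\{\boldsymbol{r}_i\}_{i\in \Phi_2}$ be the Poisson points located based on a Poisson point process $\Phi_2$ in $\mathbb{R}^2$, consider the Voronoi tessellation constructed by these points, and let $\mathcal{V}_0$ be the Voronoi cell associated with $\boldsymbol{r}_0$. Then, for any location $\boldsymbol{x}\in\mathbb{R}^2$, the quantity $\mathbbm{1}(\boldsymbol{x} \in \mathcal{V}_0)$ can be expressed as the following product of functions over $\Phi_2$: $$\mathbbm{1}(\boldsymbol{x} \in \mathcal{V}_0) = \prod_{k\in \Phi_2 \backslash \{0\} } \mathbbm{1}\big( \boldsymbol{x} \in M_0(\boldsymbol{r}_k) \big),$$ where $$M_0(\boldsymbol{r}_k) := \big\{\boldsymbol{r}'\in \mathbb{R}^2 ~\big|~ \|\boldsymbol{r}'-\boldsymbol{r}_0\| \leq \|\boldsymbol{r}'-\boldsymbol{r}_k\| \big\}.$$ Moreover, for any given $\boldsymbol{x}\in\mathbb{R}^2$, $$\big\{ \boldsymbol{r} \in \mathbb{R}^2 \;\big|\; \boldsymbol{x} \in M_0(\boldsymbol{r}) \big\} = B_c(\boldsymbol{r};\boldsymbol{x},\|\boldsymbol{x}\|),$$ where $B_c(\boldsymbol{r};\boldsymbol{x},\|\boldsymbol{x}\|)$ denotes the space exterior to the circle centered at $\boldsymbol{x}$ with radius $\|\boldsymbol{x}\|$.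
   Context: $\mathbbm{1}(\cdot)$ is the indicator function and $\|\cdot\|$ the Euclidean norm. The notation $k\in\Phi_2\backslash\{0\}$ means that $k$ ranges over the indices of all points of $\Phi_2$ other than $\boldsymbol{r}_0$. The Voronoi cell $\mathcal{V}_0$ is the set of locations in $\mathbb{R}^2$ whose distance to $\boldsymbol{r}_0$ is at most their distance to any other point $\boldsymbol{r}_k$ of the process. For a general $\boldsymbol{r}\in\mathbb{R}^2$, $M_0(\boldsymbol{r})$ is given by the same formula as $M_0(\boldsymbol{r}_k)$ with $\boldsymbol{r}_k$ replaced by $\boldsymbol{r}$; in $B_c(\boldsymbol{r};\boldsymbol{x},\|\boldsymbol{x}\|)$ the first argument $\boldsymbol{r}$ is the variable running over the region.
   Formalization: The second identity with radius ‖x‖ fails unless r_0 is suitably placed, e.g. at the origin; it is stated with radius ‖x‖ for r_0 = 0 and with radius ‖x − r_0‖ for general r_0, and the exterior includes the circle itself. *)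

theory Defs
  imports "HOL-Probability.Probability"
begin

type_synonym plane = "real ^ 2"

text \<open>A random collection of points in the plane is given by a random index set \<open>I \<omega>\<close>
  (possibly finite) and the locations \<open>r i \<omega>\<close> for \<open>i \<in> I \<omega>\<close>. Counting indices rather than
  locations takes care of multiplicities, so the intensity measure may have atoms.\<close>

definition point_count ::
  "('w \<Rightarrow> nat set) \<Rightarrow> (nat \<Rightarrow> 'w \<Rightarrow> plane) \<Rightarrow> plane set \<Rightarrow> 'w \<Rightarrow> nat" where
  "point_count I r B \<omega> = card {i \<in> I \<omega>. r i \<omega> \<in> B}"

text \<open>As usual for point processes, every realization is locally finite. The intensity measure
  \<open>\<Lambda>\<close> is an arbitrary locally finite Borel measure; the homogeneous process of density \<open>c\<close> has
  \<open>\<Lambda> = density lborel (\<lambda>_. c)\<close>. The Poisson probabilities are written out because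
  \<open>poisson_pmf\<close> is specified for positive rates only, while \<open>\<Lambda> B = 0\<close> must be
  covered.\<close>

definition poisson_point_process ::
  "'w measure \<Rightarrow> plane measure \<Rightarrow> ('w \<Rightarrow> nat set) \<Rightarrow> (nat \<Rightarrow> 'w \<Rightarrow> plane) \<Rightarrow> bool" where
  "poisson_point_process M \<Lambda> I r \<longleftrightarrow>
     prob_space M \<and>
     sets \<Lambda> = sets borel \<and>
     (\<forall>B \<in> sets borel. bounded B \<longrightarrow> emeasure \<Lambda> B < \<infinity>) \<and>
     (\<forall>\<omega> \<in> space M. \<forall>B. bounded B \<longrightarrow> finite {i \<in> I \<omega>. r i \<omega> \<in> B}) \<and>
     (\<forall>B \<in> sets borel. bounded B \<longrightarrow>
        point_count I r B \<in> measurable M (count_space UNIV) \<and>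
        (\<forall>n. measure M {\<omega> \<in> space M. point_count I r B \<omega> = n}
               = measure \<Lambda> B ^ n / fact n * exp (- measure \<Lambda> B))) \<and>
     (\<forall>n (B :: nat \<Rightarrow> plane set).
        (\<forall>i<n. B i \<in> sets borel \<and> bounded (B i)) \<and> disjoint_family_on B {..<n} \<longrightarrow>
        prob_space.indep_vars M (\<lambda>_. count_space UNIV) (\<lambda>i. point_count I r (B i)) {..<n})"

definition voronoi_cell :: "nat set \<Rightarrow> (nat \<Rightarrow> plane) \<Rightarrow> nat \<Rightarrow> plane set" where
  "voronoi_cell J p i = {x. \<forall>k \<in> J - {i}. dist x (p i) \<le> dist x (p k)}"

text \<open>The first argument is the location of the reference point \<open>r\<^sub>0\<close>.\<close>

definition M0 :: "plane \<Rightarrow> plane \<Rightarrow> plane set" where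
  "M0 r0 y = {r'. norm (r' - r0) \<le> norm (r' - y)}"

text \<open>The exterior contains the circle itself: a point \<open>y\<close> with \<open>norm (x - y) = norm (x - r0)\<close>
  satisfies the non-strict inequality defining \<open>x \<in> M0 r0 y\<close>.\<close>

definition circle_exterior :: "plane \<Rightarrow> real \<Rightarrow> plane set" where
  "circle_exterior x \<rho> = {y. \<rho> \<le> dist y x}"

end

theory Submission imports Defs begin

text \<open>A location \<open>x\<close> lies in the cell of \<open>r\<^sub>0\<close> exactly when no other point \<open>r\<^sub>k\<close> is strictly
  closer to \<open>x\<close>, so the indicator of the cell is formally the product of the indicators
  of the sets \<open>M0 r\<^sub>0 r\<^sub>k\<close>. What makes this an honest convergent product is local finiteness. The
  factor of \<open>r\<^sub>k\<close> vanishes precisely when \<open>r\<^sub>k\<close> falls into the open disc around \<open>x\<close> whose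
  boundary circle passes through \<open>r\<^sub>0\<close>; only finitely many points do so, and every other factor is \<open>1\<close>. This
  matters because \<open>has_prod\<close> tolerates a vanishing factor only if the product of the factors
  beyond some index converges to a nonzero limit: a product with infinitely many zero factors
  has no value in this sense. The description of the failing points by a disc is the second
  assertion, and it drives the first one: discs are bounded, and a realization of the
  process has finitely many points in a bounded set.\<close>

lemma mem_M0_iff_circle_exterior:
  "x \<in> M0 c y \<longleftrightarrow> y \<in> circle_exterior x (norm (x - c))"
  by (simp add: M0_def circle_exterior_def dist_norm norm_minus_commute)

lemma voronoi_cell_eq_Inter_M0:
  "voronoi_cell J p i = (\<Inter>k \<in> J - {i}. M0 (p i) (p k))"
  by (auto simp: voronoi_cell_def M0_def dist_norm)

text \<open>The points strictly closer to \<open>x\<close> than \<open>c\<close> all lie in one disc, and local finiteness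
  applies to it.\<close>

lemma finite_not_mem_M0:
  fixes p :: "nat \<Rightarrow> plane"
  assumes "\<And>B. bounded B \<Longrightarrow> finite {k \<in> J. p k \<in> B}"
  shows "finite {k \<in> J - {i}. x \<notin> M0 c (p k)}"
proof (rule finite_subset)
  show "{k \<in> J - {i}. x \<notin> M0 c (p k)} \<subseteq> {k \<in> J. p k \<in> ball x (norm (x - c))}"
    by (auto simp: mem_M0_iff_circle_exterior circle_exterior_def dist_commute)
  show "finite {k \<in> J. p k \<in> ball x (norm (x - c))}"
    by (rule assms) simp
qed

text \<open>The product is a finite one over the indices \<open>N\<close> of the violated conditions
  \<open>x \<in> M0 (p i) (p k)\<close>.
  Each of these factors is \<open>0\<close>, so the value is \<open>1\<close> if \<open>N\<close> is empty and \<open>0\<close> otherwise.\<close>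

lemma has_prod_indicator_voronoi_cell:
  fixes p :: "nat \<Rightarrow> plane"
  assumes "\<And>B. bounded B \<Longrightarrow> finite {k \<in> J. p k \<in> B}"
  shows "(\<lambda>k. if k \<in> J - {i} then indicat_real (M0 (p i) (p k)) x else 1)
           has_prod indicat_real (voronoi_cell J p i) x"
    (is "?f has_prod _")
proof -
  define N where "N = {k \<in> J - {i}. x \<notin> M0 (p i) (p k)}"
  have fin: "finite N"
    unfolding N_def using assms by (rule finite_not_mem_M0)
  have "?f has_prod (\<Prod>k\<in>N. ?f k)"
    using fin by (rule has_prod_finite) (auto simp: N_def)
  also have "(\<Prod>k\<in>N. ?f k) = (\<Prod>k\<in>N. 0)"
    by (rule prod.cong) (auto simp: N_def)
  also have "\<dots> = indicat_real (voronoi_cell J p i) x"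
  proof (cases "N = {}")
    case True
    moreover from True have "x \<in> voronoi_cell J p i"
      by (auto simp: N_def voronoi_cell_eq_Inter_M0)
    ultimately show ?thesis by simp
  next
    case False
    moreover from False have "x \<notin> voronoi_cell J p i"
      by (auto simp: N_def voronoi_cell_eq_Inter_M0)
    ultimately show ?thesis using fin by (simp add: card_gt_0_iff)
  qed
  finally show ?thesis .
qed

theorem lemma2:
  fixes M :: "'w measure" and \<Lambda> :: "plane measure"
    and I :: "'w \<Rightarrow> nat set" and r :: "nat \<Rightarrow> 'w \<Rightarrow> plane"
  assumes "poisson_point_process M \<Lambda> I r"
  shows "(\<forall>\<omega> \<in> space M. 0 \<in> I \<omega> \<longrightarrow> (\<forall>x.
            (\<lambda>k. if k \<in> I \<omega> - {0} then indicat_real (M0 (r 0 \<omega>) (r k \<omega>)) x else 1)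
              has_prod indicat_real (voronoi_cell (I \<omega>) (\<lambda>k. r k \<omega>) 0) x
          \<and> {y. x \<in> M0 (r 0 \<omega>) y} = circle_exterior x (norm (x - r 0 \<omega>))))
       \<and> (\<forall>x. {y. x \<in> M0 0 y} = circle_exterior x (norm x))"
proof (intro conjI ballI allI impI)
  fix \<omega> x
  assume "\<omega> \<in> space M"
  then have "finite {k \<in> I \<omega>. r k \<omega> \<in> B}" if "bounded B" for B
    using assms that by (auto simp: poisson_point_process_def)
  then show "(\<lambda>k. if k \<in> I \<omega> - {0} then indicat_real (M0 (r 0 \<omega>) (r k \<omega>)) x else 1)
      has_prod indicat_real (voronoi_cell (I \<omega>) (\<lambda>k. r k \<omega>) 0) x"
    by (rule has_prod_indicator_voronoi_cell)
  show "{y. x \<in> M0 (r 0 \<omega>) y} = circle_exterior x (norm (x - r 0 \<omega>))"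
    by (simp add: mem_M0_iff_circle_exterior)
next
  fix x
  show "{y. x \<in> M0 0 y} = circle_exterior x (norm x)"
    by (simp add: mem_M0_iff_circle_exterior)
qed

end
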